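(* Let $\Lambda$ be an ordered abelian group. The following are equivalent: (a) For every positive $\lambda_0 \in \Lambda$, the set $\{t \in \Lambda : 0 \leq 2t \leq \lambda_0\}$ has a maximum. (b) Every $\Lambda$-metric space that satisfies axioms (1) and (2) also satisfies axiom (3).
   Context: An ordered abelian group $(\Lambda,+)$ is an abelian group with a translation-invariant total order. A $\Lambda$-metric space is a set $X$ with a function $d\colon X\times X\to\Lambda$ that is positive definite ($d(x,y)\ge 0$, with equality iff $x=y$), symmetric and satisfies the triangle inequality. A closed $\Lambda$-interval is a set $[a,b]=\{\lambda\in\Lambda : a\le\lambda\le b\}$ with $a\le b$ in $\Lambda$, equipped with the $\Lambda$-metric $d_\Lambda(t,t')=|t'-t|$. A segment in $X$ is the image $s=\varphi([a,b])\subseteq X$ of an isometric embedding (distance-preserving map) $\varphi\colon[a,b]\to X$ of a closed $\Lambda$-interval; the endpoints of $s$ are $\varphi(a)$ and $\varphi(b)$ (the set of endpoints does not depend on $\varphi$). $X$ is geodesic if for any $p,q\in X$ there exists a segment with endpoints $p$ and $q$. The axioms for a $\Lambda$-metric space $(X,d)$ are: (1) $(X,d)$ is geodesic. (2) If two segments $s,s'\subseteq X$ intersect in a single point $s\cap s'=\{p\}$, which is an endpoint of $s$ and of $s'$, then their union $s\cup s'$ is a segment. (3) If two segments $s,s'\subseteq X$ have an endpoint in common, then their intersection $s\cap s'$ is a segment. An element $r$ is the maximum of a subset $S\subseteq\Lambda$ if $r\in S$ and $s\le r$ for all $s\in S$. *)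

theory Defs
  imports Main
begin

(* The triangle inequality and all other laws are only required on the carrier X;
   the values of d outside X are irrelevant.  X may be empty. *)
locale lambda_metric_space =
  fixes X :: "'x set" and d :: "'x \<Rightarrow> 'x \<Rightarrow> 'l::linordered_ab_group_add"
  assumes nonneg: "x \<in> X \<Longrightarrow> y \<in> X \<Longrightarrow> 0 \<le> d x y"
    and zero_iff: "x \<in> X \<Longrightarrow> y \<in> X \<Longrightarrow> d x y = 0 \<longleftrightarrow> x = y"
    and sym: "x \<in> X \<Longrightarrow> y \<in> X \<Longrightarrow> d x y = d y x"
    and triangle: "x \<in> X \<Longrightarrow> y \<in> X \<Longrightarrow> z \<in> X \<Longrightarrow> d x z \<le> d x y + d y z"

(* The distance |t' - t|; the class linordered_ab_group_add does not provide abs. *)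
definition dist_Lambda :: "'l::linordered_ab_group_add \<Rightarrow> 'l \<Rightarrow> 'l" where
  "dist_Lambda t t' = max (t' - t) (t - t')"

definition isometric_embedding ::
    "'x set \<Rightarrow> ('x \<Rightarrow> 'x \<Rightarrow> 'l::linordered_ab_group_add) \<Rightarrow> 'l \<Rightarrow> 'l \<Rightarrow> ('l \<Rightarrow> 'x) \<Rightarrow> bool" where
  "isometric_embedding X d a b \<phi> \<longleftrightarrow>
     \<phi> ` {a..b} \<subseteq> X \<and> (\<forall>t\<in>{a..b}. \<forall>t'\<in>{a..b}. d (\<phi> t) (\<phi> t') = dist_Lambda t t')"

(* s is a segment whose set of endpoints is E.  Degenerate intervals a = b are allowed,
   so singletons are segments, with E a singleton. *)
definition segment_ends ::
    "'x set \<Rightarrow> ('x \<Rightarrow> 'x \<Rightarrow> 'l::linordered_ab_group_add) \<Rightarrow> 'x set \<Rightarrow> 'x set \<Rightarrow> bool" where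
  "segment_ends X d s E \<longleftrightarrow>
     (\<exists>a b \<phi>. a \<le> b \<and> isometric_embedding X d a b \<phi> \<and> s = \<phi> ` {a..b} \<and> E = {\<phi> a, \<phi> b})"

definition segment ::
    "'x set \<Rightarrow> ('x \<Rightarrow> 'x \<Rightarrow> 'l::linordered_ab_group_add) \<Rightarrow> 'x set \<Rightarrow> bool" where
  "segment X d s \<longleftrightarrow> (\<exists>E. segment_ends X d s E)"

definition endpoint ::
    "'x set \<Rightarrow> ('x \<Rightarrow> 'x \<Rightarrow> 'l::linordered_ab_group_add) \<Rightarrow> 'x set \<Rightarrow> 'x \<Rightarrow> bool" where
  "endpoint X d s p \<longleftrightarrow> (\<exists>E. segment_ends X d s E \<and> p \<in> E)"

definition axiom1 :: "'x set \<Rightarrow> ('x \<Rightarrow> 'x \<Rightarrow> 'l::linordered_ab_group_add) \<Rightarrow> bool" where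
  "axiom1 X d \<longleftrightarrow> (\<forall>p\<in>X. \<forall>q\<in>X. \<exists>s. segment_ends X d s {p, q})"

definition axiom2 :: "'x set \<Rightarrow> ('x \<Rightarrow> 'x \<Rightarrow> 'l::linordered_ab_group_add) \<Rightarrow> bool" where
  "axiom2 X d \<longleftrightarrow>
     (\<forall>s s' p. segment X d s \<and> segment X d s' \<and> s \<inter> s' = {p} \<and>
        endpoint X d s p \<and> endpoint X d s' p \<longrightarrow> segment X d (s \<union> s'))"

definition axiom3 :: "'x set \<Rightarrow> ('x \<Rightarrow> 'x \<Rightarrow> 'l::linordered_ab_group_add) \<Rightarrow> bool" where
  "axiom3 X d \<longleftrightarrow>
     (\<forall>s s'. segment X d s \<and> segment X d s' \<and>
        (\<exists>p. endpoint X d s p \<and> endpoint X d s' p) \<longrightarrow> segment X d (s \<inter> s'))"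

definition is_maximum :: "'l::linorder \<Rightarrow> 'l set \<Rightarrow> bool" where
  "is_maximum r S \<longleftrightarrow> r \<in> S \<and> (\<forall>s\<in>S. s \<le> r)"

(* Condition on the ordered group 'l; 2t is written t + t, there being no numerals here. *)
definition halves_have_maximum :: "'l::linordered_ab_group_add itself \<Rightarrow> bool" where
  "halves_have_maximum _ \<longleftrightarrow>
     (\<forall>l0::'l. 0 < l0 \<longrightarrow> (\<exists>r. is_maximum r {t. 0 \<le> t + t \<and> t + t \<le> l0}))"

(* HOL cannot quantify over the types from which carriers are drawn inside a formula, so this
   condition ranges over all 'l-metric spaces whose points lie in a given type 'x. *)
definition axioms12_imply_axiom3 ::
    "'l::linordered_ab_group_add itself \<Rightarrow> 'x itself \<Rightarrow> bool" where
  "axioms12_imply_axiom3 _ _ \<longleftrightarrow>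
     (\<forall>(X::'x set) (d::'x \<Rightarrow> 'x \<Rightarrow> 'l).
        lambda_metric_space X d \<and> axiom1 X d \<and> axiom2 X d \<longrightarrow> axiom3 X d)"

end

theory Submission imports Defs begin

text \<open>
  Axiom 2 says that two geodesics issuing from a point meet again unless the distance of their
  ends is the sum of their lengths.  Hence, if \<open>m\<close> lies on a geodesic from \<open>x\<close> to \<open>y\<close>, then for
  every \<open>z\<close> the distance to \<open>x\<close> or the distance to \<open>y\<close> is attained through \<open>m\<close>: a geodesic
  from \<open>m\<close> to \<open>z\<close> cannot start in both directions.

  If the halves have maxima, every \<open>l > 0\<close> is \<open>r + r\<close> or \<open>r + r + e\<close> with \<open>e\<close> the least positive
  element.  In the second case \<open>l\<close> cannot be a doubled Gromov product \<open>d p x + d x y - d p y\<close>: the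
  points at distance \<open>r\<close> and \<open>r + e\<close> from \<open>x\<close> on a geodesic from \<open>x\<close> to \<open>y\<close> would be equidistant
  from \<open>p\<close> and \<open>e\<close> apart.  So every triangle has a center on each of its sides, which yields
  uniqueness of geodesics and identifies the intersection in axiom 3.

  Conversely, if \<open>H = {t. 0 \<le> 2t \<le> l0}\<close> has no maximum, glue three segments of length \<open>l0\<close> to a
  triangle by identifying adjacent sides along copies of \<open>H\<close>.  Two sides then intersect in a copy
  of \<open>H\<close>, which is not a segment.
\<close>


section \<open>Doubling and distance in an ordered abelian group\<close>

lemma double_le_iff:
  fixes a b :: "'l::linordered_ab_group_add"
  shows "a + a \<le> b + b \<longleftrightarrow> a \<le> b"
  using add_strict_mono[of b a b a] add_mono[of a b a b] by force

lemma double_less_iff: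
  fixes a b :: "'l::linordered_ab_group_add"
  shows "a + a < b + b \<longleftrightarrow> a < b"
  using double_le_iff[of b a] by (simp flip: not_le)

lemma double_eq_iff:
  fixes a b :: "'l::linordered_ab_group_add"
  shows "a + a = b + b \<longleftrightarrow> a = b"
  using double_le_iff[of a b] double_le_iff[of b a] by auto

lemma dist_Lambda_le: "t \<le> t' \<Longrightarrow> dist_Lambda t t' = t' - t"
  by (metis diff_ge_0_iff_ge diff_le_0_iff_le dist_Lambda_def max.absorb1 order_trans)

lemma dist_Lambda_commute: "dist_Lambda t t' = dist_Lambda t' t"
  by (simp add: dist_Lambda_def max.commute)

lemma dist_Lambda_cases: "dist_Lambda x y = r \<Longrightarrow> y = x + r \<or> y = x - r"
  by (auto simp: dist_Lambda_def max_def split: if_splits)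

lemma dist_Lambda_le_iff: "dist_Lambda s t \<le> c \<longleftrightarrow> t - s \<le> c \<and> s - t \<le> c"
  by (simp add: dist_Lambda_def)

lemma dist_Lambda_ge: "t - s \<le> dist_Lambda s t" "s - t \<le> dist_Lambda s t"
  by (simp_all add: dist_Lambda_def)

lemma dist_Lambda_nonneg: "0 \<le> dist_Lambda s t"
  unfolding dist_Lambda_def le_max_iff_disj by auto

lemma dist_Lambda_zero_iff: "dist_Lambda s t = 0 \<longleftrightarrow> s = t"
  by (auto simp: dist_Lambda_def max_def)

lemma dist_Lambda_triangle: "dist_Lambda s u \<le> dist_Lambda s t + dist_Lambda t u"
  unfolding dist_Lambda_le_iff
  using add_mono[OF dist_Lambda_ge(1)[of t s] dist_Lambda_ge(1)[of u t]]
    add_mono[OF dist_Lambda_ge(2)[of s t] dist_Lambda_ge(2)[of t u]] by simp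

section \<open>Geodesics and segments\<close>

text \<open>Starting the interval at 0 makes the parameter of a point its distance from the initial
  point.\<close>

definition geodesic ::
    "'x set \<Rightarrow> ('x \<Rightarrow> 'x \<Rightarrow> 'l::linordered_ab_group_add) \<Rightarrow> 'l \<Rightarrow> ('l \<Rightarrow> 'x) \<Rightarrow> bool" where
  "geodesic X d a \<phi> \<longleftrightarrow> 0 \<le> a \<and> isometric_embedding X d 0 a \<phi>"

lemma geodesic_nonneg: "geodesic X d a \<phi> \<Longrightarrow> 0 \<le> a"
  by (simp add: geodesic_def)

lemma geodesic_in: "geodesic X d a \<phi> \<Longrightarrow> 0 \<le> t \<Longrightarrow> t \<le> a \<Longrightarrow> \<phi> t \<in> X"
  by (auto simp: geodesic_def isometric_embedding_def)

lemma geodesic_dist: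
  "geodesic X d a \<phi> \<Longrightarrow> 0 \<le> t \<Longrightarrow> t \<le> t' \<Longrightarrow> t' \<le> a \<Longrightarrow> d (\<phi> t) (\<phi> t') = t' - t"
  by (auto simp: geodesic_def isometric_embedding_def dist_Lambda_le)

lemma geodesic_from: "geodesic X d a \<phi> \<Longrightarrow> 0 \<le> t \<Longrightarrow> t \<le> a \<Longrightarrow> d (\<phi> 0) (\<phi> t) = t"
  by (simp add: geodesic_dist)

text \<open>With \<open>geodesic_backward\<close>, this yields the two geodesics that leave an inner
  point \<open>\<phi> k\<close> in opposite directions.\<close>

lemma geodesic_forward:
  assumes "geodesic X d a \<phi>" "0 \<le> k" "0 \<le> l" "k + l \<le> a"
  shows "geodesic X d l (\<lambda>t. \<phi> (k + t))"
proof -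
  have "0 \<le> k + t \<and> k + t \<le> a" if "0 \<le> t" "t \<le> l" for t
    using that assms by (metis add_left_mono add_nonneg_nonneg order_trans)
  then show ?thesis
    using assms
    by (auto simp: geodesic_def isometric_embedding_def dist_Lambda_def image_subset_iff)
qed

lemma geodesic_backward:
  assumes "geodesic X d a \<phi>" "0 \<le> l" "l \<le> k" "k \<le> a"
  shows "geodesic X d l (\<lambda>t. \<phi> (k - t))"
proof -
  have "0 \<le> k - t \<and> k - t \<le> a" if "0 \<le> t" "t \<le> l" for t
    using that assms by (auto intro: order_trans simp: diff_le_eq add_increasing2)
  then show ?thesis
    using assms
    by (auto simp: geodesic_def isometric_embedding_def dist_Lambda_def image_subset_iff max.commute)
qed

lemma geodesic_segment_ends:
  "geodesic X d a \<phi> \<Longrightarrow> segment_ends X d (\<phi> ` {0..a}) {\<phi> 0, \<phi> a}"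
  unfolding geodesic_def segment_ends_def by blast

text \<open>Translating or reflecting the parameter interval moves the chosen endpoint to 0. Both
  are needed, as the ends are given only as an unordered set.\<close>

lemma segment_ends_geodesic:
  assumes "segment_ends X d s {p, q}"
  obtains a \<phi> where "geodesic X d a \<phi>" "\<phi> 0 = p" "\<phi> a = q" "s = \<phi> ` {0..a}"
proof -
  obtain u v \<theta> where uv: "u \<le> v" and iso: "isometric_embedding X d u v \<theta>"
    and s: "s = \<theta> ` {u..v}" and pq: "{p, q} = {\<theta> u, \<theta> v}"
    using assms unfolding segment_ends_def by auto
  have im1: "(\<lambda>t. u + t) ` {0..v - u} = {u..v}"
  proof (intro equalityI subsetI)
    fix t assume "t \<in> {u..v}"
    then show "t \<in> (\<lambda>t. u + t) ` {0..v - u}" by (intro image_eqI[of _ _ "t - u"]) auto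
  qed (auto simp: le_diff_eq add.commute)
  have im2: "(\<lambda>t. v - t) ` {0..v - u} = {u..v}"
  proof (intro equalityI subsetI)
    fix t assume "t \<in> {u..v}"
    then show "t \<in> (\<lambda>t. v - t) ` {0..v - u}" by (intro image_eqI[of _ _ "v - t"]) auto
  qed (auto simp: le_diff_eq add.commute)
  consider "p = \<theta> u" "q = \<theta> v" | "p = \<theta> v" "q = \<theta> u"
    using pq by (auto simp: doubleton_eq_iff)
  then show thesis
  proof cases
    case 1
    have "geodesic X d (v - u) (\<lambda>t. \<theta> (u + t))"
      using iso uv unfolding geodesic_def isometric_embedding_def
      by (auto simp: dist_Lambda_def image_subset_iff le_diff_eq add.commute add_increasing2)
    moreover have "s = (\<lambda>t. \<theta> (u + t)) ` {0..v - u}"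
      unfolding s im1[symmetric] by (simp add: image_image)
    ultimately show thesis using that 1 by (metis add.right_neutral add.commute diff_add_cancel)
  next
    case 2
    have "u \<le> v - t \<and> v - t \<le> v" if "0 \<le> t" "t \<le> v - u" for t
      using that by (auto simp: le_diff_eq diff_le_eq add.commute)
    then have "geodesic X d (v - u) (\<lambda>t. \<theta> (v - t))"
      using iso uv unfolding geodesic_def isometric_embedding_def
      by (auto simp: dist_Lambda_def image_subset_iff max.commute)
    moreover have "s = (\<lambda>t. \<theta> (v - t)) ` {0..v - u}"
      unfolding s im2[symmetric] by (simp add: image_image)
    ultimately show thesis using that[of "v - u" "\<lambda>t. \<theta> (v - t)"] 2 by simp
  qed
qed

lemma endpoint_geodesic:
  assumes "endpoint X d s p"
  obtains a \<phi> where "geodesic X d a \<phi>" "\<phi> 0 = p" "s = \<phi> ` {0..a}"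
proof -
  obtain E where "segment_ends X d s E" "p \<in> E"
    using assms by (auto simp: endpoint_def)
  moreover from this obtain q where "E = {p, q}"
    by (auto simp: segment_ends_def)
  ultimately show thesis using segment_ends_geodesic that by metis
qed

lemma endpoint_of_geodesic:
  "geodesic X d a \<phi> \<Longrightarrow> endpoint X d (\<phi> ` {0..a}) (\<phi> 0)"
  unfolding endpoint_def using geodesic_segment_ends by blast

lemma segment_of_geodesic: "geodesic X d a \<phi> \<Longrightarrow> segment X d (\<phi> ` {0..a})"
  unfolding segment_def using geodesic_segment_ends by blast

lemma geodesic_between:
  assumes "axiom1 X d" "x \<in> X" "y \<in> X"
  obtains \<phi> where "geodesic X d (d x y) \<phi>" "\<phi> 0 = x" "\<phi> (d x y) = y"
proof -
  obtain s where "segment_ends X d s {x, y}"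
    using assms unfolding axiom1_def by blast
  then obtain a \<phi> where "geodesic X d a \<phi>" "\<phi> 0 = x" "\<phi> a = y"
    by (rule segment_ends_geodesic)
  moreover from this have "d x y = a"
    using geodesic_from[of X d a \<phi> a] geodesic_nonneg by auto
  ultimately show thesis using that by blast
qed

section \<open>Consequences of axiom 2\<close>

context lambda_metric_space
begin

lemma geodesics_meet_same_parameter:
  assumes "geodesic X d a \<phi>" "geodesic X d b \<psi>" "\<phi> 0 = \<psi> 0"
    and "0 \<le> t" "t \<le> a" "0 \<le> t'" "t' \<le> b" "\<phi> t = \<psi> t'"
  shows "t = t'"
  using assms by (metis geodesic_from)

text \<open>If the geodesics met only at their start, their union would be a segment by axiom 2.
  There \<open>\<phi> a\<close> and \<open>\<psi> a\<close> are distinct and equally far from the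
  start, hence on opposite sides of it; \<open>\<psi> b\<close> lies beyond \<open>\<psi> a\<close>,
  so the ends would be \<open>a + b\<close> apart. The order \<open>a \<le> b\<close> puts
  \<open>a\<close> in the domain of \<open>\<psi>\<close>.\<close>

lemma geodesics_meet_aux:
  assumes ax2: "axiom2 X d"
    and \<phi>: "geodesic X d a \<phi>" and \<psi>: "geodesic X d b \<psi>" and eq0: "\<phi> 0 = \<psi> 0"
    and ab: "a \<le> b" and ne: "d (\<phi> a) (\<psi> b) \<noteq> a + b"
  shows "\<exists>t. 0 < t \<and> t \<le> a \<and> t \<le> b \<and> \<phi> t = \<psi> t"
proof (rule ccontr)
  assume contra: "\<not> ?thesis"
  have a0: "0 \<le> a" and b0: "0 \<le> b" using \<phi> \<psi> by (auto dest: geodesic_nonneg)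
  have apos: "0 < a"
  proof (rule ccontr)
    assume "\<not> 0 < a"
    then have "a = 0" using a0 by auto
    then show False using ne geodesic_from[OF \<psi> b0] eq0 by simp
  qed
  have "\<phi> ` {0..a} \<inter> \<psi> ` {0..b} = {\<phi> 0}"
  proof (intro equalityI subsetI)
    fix z assume "z \<in> \<phi> ` {0..a} \<inter> \<psi> ` {0..b}"
    then obtain t t' where t: "0 \<le> t" "t \<le> a" "0 \<le> t'" "t' \<le> b" "z = \<phi> t" "z = \<psi> t'" by auto
    then have "t = t'" using geodesics_meet_same_parameter[OF \<phi> \<psi> eq0] by metis
    then have "t = 0" using contra t by force
    then show "z \<in> {\<phi> 0}" using t by simp
  next
    fix z assume "z \<in> {\<phi> 0}"
    then have "z = \<phi> 0" "z = \<psi> 0" using eq0 by auto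
    moreover have "0 \<in> {0..a}" "0 \<in> {0..b}" using a0 b0 by auto
    ultimately show "z \<in> \<phi> ` {0..a} \<inter> \<psi> ` {0..b}" by blast
  qed
  then have "segment X d (\<phi> ` {0..a} \<union> \<psi> ` {0..b})"
    using ax2 endpoint_of_geodesic[OF \<phi>] endpoint_of_geodesic[OF \<psi>] eq0
      segment_of_geodesic[OF \<phi>] segment_of_geodesic[OF \<psi>]
    unfolding axiom2_def by metis
  then obtain u v \<theta> where iso: "isometric_embedding X d u v \<theta>"
    and s: "\<phi> ` {0..a} \<union> \<psi> ` {0..b} = \<theta> ` {u..v}"
    unfolding segment_def segment_ends_def by blast
  have "\<phi> 0 \<in> \<theta> ` {u..v}" "\<phi> a \<in> \<theta> ` {u..v}" "\<psi> a \<in> \<theta> ` {u..v}" "\<psi> b \<in> \<theta> ` {u..v}"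
    using s a0 ab b0 by (auto simp flip: s)
  then obtain w x y z where in_uv: "w \<in> {u..v}" "x \<in> {u..v}" "y \<in> {u..v}" "z \<in> {u..v}"
    and img: "\<phi> 0 = \<theta> w" "\<phi> a = \<theta> x" "\<psi> a = \<theta> y" "\<psi> b = \<theta> z" by blast
  have D: "d (\<theta> i) (\<theta> j) = dist_Lambda i j" if "i \<in> {u..v}" "j \<in> {u..v}" for i j
    using iso that unfolding isometric_embedding_def by blast
  have "x = w + a \<or> x = w - a"
    using D[OF in_uv(1,2)] img geodesic_from[OF \<phi> a0] by (intro dist_Lambda_cases) auto
  moreover have "y = w + a \<or> y = w - a"
    using D[OF in_uv(1,3)] img geodesic_from[OF \<psi> a0 ab] eq0 by (intro dist_Lambda_cases) auto
  \<comment> \<open>\<open>\<phi> a\<close> and \<open>\<psi> a\<close> differ by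
    \<open>contra\<close>, so they take the two different positions at distance \<open>a\<close>
    from \<open>w\<close>.\<close>
  moreover have "x \<noteq> y"
    using img contra apos ab by auto
  ultimately consider "x = w + a" "y = w - a" | "x = w - a" "y = w + a" by blast
  moreover have z1: "z = w + b \<or> z = w - b"
    using D[OF in_uv(1,4)] img geodesic_from[OF \<psi> b0] eq0 by (intro dist_Lambda_cases) auto
  moreover have z2: "z = y + (b - a) \<or> z = y - (b - a)"
    using D[OF in_uv(3,4)] img geodesic_dist[OF \<psi> a0 ab] by (intro dist_Lambda_cases) auto
  moreover have xz: "dist_Lambda x z \<noteq> a + b"
    using D[OF in_uv(2,4)] img ne by auto
  moreover have opp: "dist_Lambda (w - a) (w + b) = a + b" "dist_Lambda (w + a) (w - b) = a + b"
    using a0 b0 dist_Lambda_le[of "w - a" "w + b"] dist_Lambda_le[of "w - b" "w + a"]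
    unfolding dist_Lambda_commute[of "w + a"] by (simp_all add: algebra_simps add_increasing2)
  moreover have "a + a \<noteq> 0" "b + b \<noteq> 0" using apos ab double_eq_iff[of _ 0] by auto
  ultimately show False
  proof cases
    case 1
    \<comment> \<open>The other position of \<open>z\<close> is excluded by \<open>xz\<close> and
      \<open>opp\<close>. This one puts \<open>\<psi> b\<close> on the side of
      \<open>\<phi> a\<close>, where its distance \<open>b - a\<close> from \<open>\<psi> a\<close>
      forces \<open>a\<close> or \<open>b\<close> to vanish.\<close>
    then have "z = w + b" using z1 xz opp by auto
    then have "a + a = 0 \<or> b + b = 0"
      using z2 unfolding 1(2) \<open>z = w + b\<close> by (elim disjE) simp_all
    then show False using \<open>a + a \<noteq> 0\<close> \<open>b + b \<noteq> 0\<close> by blast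
  next
    case 2
    then have "z = w - b" using z1 xz opp by auto
    then have "a + a = 0 \<or> b + b = 0"
      using z2 unfolding 2(2) \<open>z = w - b\<close> by (elim disjE) simp_all
    then show False using \<open>a + a \<noteq> 0\<close> \<open>b + b \<noteq> 0\<close> by blast
  qed
qed

lemma geodesics_meet:
  assumes ax2: "axiom2 X d"
    and \<phi>: "geodesic X d a \<phi>" and \<psi>: "geodesic X d b \<psi>" and eq0: "\<phi> 0 = \<psi> 0"
    and ne: "d (\<phi> a) (\<psi> b) \<noteq> a + b"
  shows "\<exists>t. 0 < t \<and> t \<le> a \<and> t \<le> b \<and> \<phi> t = \<psi> t"
proof (cases "a \<le> b")
  case True
  then show ?thesis using geodesics_meet_aux assms by blast
next
  case False
  have "\<phi> a \<in> X" "\<psi> b \<in> X" using \<phi> \<psi> by (auto intro: geodesic_in dest: geodesic_nonneg)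
  then have "d (\<psi> b) (\<phi> a) \<noteq> b + a" using ne by (metis sym add.commute)
  then show ?thesis
    using geodesics_meet_aux[OF ax2 \<psi> \<phi> eq0[symmetric]] False by fastforce
qed

text \<open>Otherwise a geodesic \<open>\<gamma>\<close> from \<open>\<chi> k\<close> to
  \<open>z\<close> meets both halves of \<open>\<chi>\<close>, at parameters
  \<open>s, r > 0\<close>. The two meeting points are \<open>r + s\<close> apart along
  \<open>\<chi>\<close> but only the difference of \<open>r\<close> and \<open>s\<close> apart along
  \<open>\<gamma>\<close>.\<close>

lemma through_point_to_one_end:
  assumes ax1: "axiom1 X d" and ax2: "axiom2 X d"
    and \<chi>: "geodesic X d c \<chi>" and k: "0 \<le> k" "k \<le> c" and z: "z \<in> X"
  shows "d z (\<chi> 0) = d z (\<chi> k) + k \<or> d z (\<chi> c) = d z (\<chi> k) + (c - k)"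
proof (rule ccontr)
  assume contra: "\<not> ?thesis"
  have m: "\<chi> k \<in> X" and ends: "\<chi> 0 \<in> X" "\<chi> c \<in> X"
    using \<chi> k geodesic_in[OF \<chi>] order_trans by blast+
  obtain \<gamma> where \<gamma>: "geodesic X d (d (\<chi> k) z) \<gamma>" "\<gamma> 0 = \<chi> k" "\<gamma> (d (\<chi> k) z) = z"
    using geodesic_between[OF ax1 m z] .
  have bwd: "geodesic X d k (\<lambda>t. \<chi> (k - t))" and fwd: "geodesic X d (c - k) (\<lambda>t. \<chi> (k + t))"
    using k by (auto intro: geodesic_forward[OF \<chi>] geodesic_backward[OF \<chi>])
  obtain s where s: "0 < s" "s \<le> d (\<chi> k) z" "s \<le> k" "\<gamma> s = \<chi> (k - s)"
    using geodesics_meet[OF ax2 \<gamma>(1) bwd] \<gamma> contra sym[OF m z] by auto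
  obtain r where r: "0 < r" "r \<le> d (\<chi> k) z" "r \<le> c - k" "\<gamma> r = \<chi> (k + r)"
    using geodesics_meet[OF ax2 \<gamma>(1) fwd] \<gamma> contra sym[OF m z] by auto
  have "d (\<chi> (k - s)) (\<chi> (k + r)) = r + s"
    using geodesic_dist[OF \<chi>, of "k - s" "k + r"] r s by (auto simp: algebra_simps add_increasing2)
  moreover have "d (\<gamma> s) (\<gamma> r) = dist_Lambda s r"
    using \<gamma>(1) r(1,2) s(1,2) unfolding geodesic_def isometric_embedding_def by auto
  ultimately have "r = s + (r + s) \<or> r = s - (r + s)"
    using r s by (intro dist_Lambda_cases) auto
  then show False using r s double_eq_iff[of r 0] double_eq_iff[of s 0]
    by (auto simp: algebra_simps)
qed

lemma geodesics_concat:
  assumes \<phi>: "geodesic X d a \<phi>" and \<psi>: "geodesic X d b \<psi>" and eq0: "\<phi> 0 = \<psi> 0"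
    and opposite: "\<And>r r'. 0 < r \<Longrightarrow> r \<le> a \<Longrightarrow> 0 < r' \<Longrightarrow> r' \<le> b \<Longrightarrow> d (\<phi> r) (\<psi> r') = r + r'"
  shows "segment X d (\<phi> ` {0..a} \<union> \<psi> ` {0..b})"
proof -
  have a0: "0 \<le> a" and b0: "0 \<le> b" using \<phi> \<psi> by (auto dest: geodesic_nonneg)
  \<comment> \<open>Negative parameters run along \<open>\<phi>\<close> reversed, positive ones
    along \<open>\<psi>\<close>, and 0 is the common start.\<close>
  define \<theta> where "\<theta> u = (if u \<le> 0 then \<phi> (- u) else \<psi> u)" for u
  have \<theta>X: "\<theta> u \<in> X" if "- a \<le> u" "u \<le> b" for u
    using that geodesic_in[OF \<phi>, of "- u"] geodesic_in[OF \<psi>, of u]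
    by (auto simp: \<theta>_def minus_le_iff)
  have dist: "d (\<theta> u) (\<theta> v) = v - u" if "- a \<le> u" "u \<le> v" "v \<le> b" for u v
  proof -
    consider "v \<le> 0" | "u \<le> 0" "0 < v" | "0 < u" by fastforce
    then show ?thesis
    proof cases
      case 1
      then have "u \<le> 0" using that by auto
      moreover have "\<phi> (- u) \<in> X" "\<phi> (- v) \<in> X"
        using \<theta>X[of u] \<theta>X[of v] that 1 \<open>u \<le> 0\<close> b0 by (auto simp: \<theta>_def)
      ultimately show ?thesis
        using 1 that geodesic_dist[OF \<phi>, of "- v" "- u"] sym[of "\<phi> (- u)" "\<phi> (- v)"]
        by (simp add: \<theta>_def minus_le_iff)
    next
      case 2
      show ?thesis
      proof (cases "u = 0")
        case True
        then show ?thesis using 2 that geodesic_from[OF \<psi>, of v] eq0 by (auto simp: \<theta>_def)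
      next
        case False
        then show ?thesis using 2 that opposite[of "- u" v] by (auto simp add: \<theta>_def minus_le_iff)
      qed
    next
      case 3
      then have "\<not> u \<le> 0" "\<not> v \<le> 0" using that by auto
      then show ?thesis using that geodesic_dist[OF \<psi>, of u v] by (simp add: \<theta>_def)
    qed
  qed
  have "d (\<theta> u) (\<theta> v) = dist_Lambda u v" if "- a \<le> u" "u \<le> b" "- a \<le> v" "v \<le> b" for u v
  proof (cases "u \<le> v")
    case True
    then show ?thesis using dist[of u v] that by (simp add: dist_Lambda_le)
  next
    case False
    then show ?thesis using dist[of v u] that sym[OF \<theta>X \<theta>X, of v u]
      by (simp add: dist_Lambda_le dist_Lambda_commute[of u])
  qed
  then have "isometric_embedding X d (- a) b \<theta>"
    using \<theta>X unfolding isometric_embedding_def by auto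
  moreover have "\<theta> ` {- a..b} = \<phi> ` {0..a} \<union> \<psi> ` {0..b}"
  proof (intro equalityI subsetI)
    fix z assume "z \<in> \<phi> ` {0..a} \<union> \<psi> ` {0..b}"
    then consider t where "0 \<le> t" "t \<le> a" "z = \<phi> t" | t where "0 \<le> t" "t \<le> b" "z = \<psi> t" by auto
    then show "z \<in> \<theta> ` {- a..b}"
    proof cases
      case 1
      then have "z = \<theta> (- t)" "- t \<in> {- a..b}"
        using b0 by (auto simp: \<theta>_def intro: order_trans[of _ 0])
      then show ?thesis by blast
    next
      case 2
      then have "z = \<theta> t" "t \<in> {- a..b}"
        using a0 eq0 by (auto simp: \<theta>_def intro: order_trans[of _ 0])
      then show ?thesis by blast
    qed
  qed (auto simp: \<theta>_def minus_le_iff)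
  moreover have "- a \<le> b" using a0 b0 by (auto intro: order_trans[of _ 0])
  ultimately show ?thesis
    unfolding segment_def segment_ends_def by metis
qed

section \<open>Gromov products and axiom 3\<close>

lemma even_gromov_product:
  assumes half: "halves_have_maximum TYPE('l)"
    and ax1: "axiom1 X d" and ax2: "axiom2 X d" and X: "p \<in> X" "x \<in> X" "y \<in> X"
  shows "\<exists>k. k + k = d p x + d x y - d p y"
proof (rule ccontr)
  assume contra: "\<not> ?thesis"
  define l where "l = d p x + d x y - d p y"
  have "d p y \<le> d p x + d x y" using triangle X by blast
  then have "0 \<le> l" by (simp add: l_def)
  moreover have "l \<noteq> 0" using contra[unfolded l_def[symmetric]] by (metis add_0)
  ultimately obtain r where r: "is_maximum r {t. 0 \<le> t + t \<and> t + t \<le> l}"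
    using half unfolding halves_have_maximum_def by force
  then have r0: "0 \<le> r" and rl: "r + r \<le> l"
    and rmax: "\<And>t. 0 \<le> t \<Longrightarrow> t + t \<le> l \<Longrightarrow> t \<le> r"
    unfolding is_maximum_def by auto
  define e where "e = l - (r + r)"
  have e0: "0 < e" using rl contra unfolding e_def l_def[symmetric]
    by (metis diff_gt_0_iff_gt order_le_less)
  \<comment> \<open>Maximality of \<open>r\<close>, applied to \<open>r + t\<close>.\<close>
  have lt_double: "e < t + t" if "0 < t" for t
  proof -
    have "\<not> (r + t) + (r + t) \<le> l" using rmax[of "r + t"] that r0 by auto
    then show ?thesis unfolding e_def by (simp add: algebra_simps)
  qed
  have e_le: "e \<le> t" if "0 < t" for t
  proof (rule ccontr)
    assume "\<not> e \<le> t"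
    then have "0 < e - t" by simp
    \<comment> \<open>The doubles of \<open>t\<close> and of \<open>e - t\<close> would both exceed
      \<open>e\<close>, but they add up to \<open>e + e\<close>.\<close>
    from add_strict_mono[OF lt_double[OF this] lt_double[OF that]] show False
      by (simp add: algebra_simps)
  qed
  obtain \<chi> where \<chi>: "geodesic X d (d x y) \<chi>" "\<chi> 0 = x" "\<chi> (d x y) = y"
    using geodesic_between[OF ax1 X(2,3)] .
  have rc: "r + e \<le> d x y"
  proof (rule ccontr)
    assume "\<not> r + e \<le> d x y"
    \<comment> \<open>\<open>e\<close> is the least positive element, so the failure of
      \<open>r + e \<le> d x y\<close> leaves no room above \<open>r\<close>. This contradicts
      \<open>l \<le> d x y + d x y\<close>.\<close>
    then have "d x y \<le> r" using e_le[of "r + e - d x y"] by (simp add: algebra_simps)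
    moreover have "r + r + e \<le> d x y + d x y"
      using triangle[OF X(1,3,2)] sym[OF X(2,3)] by (simp add: e_def l_def algebra_simps)
    ultimately show False using e0 add_mono[of "d x y" r "d x y" r]
      by (metis add_increasing2 add_le_same_cancel1 leD order_trans)
  qed
  have re0: "0 \<le> r + e" using r0 e0 by simp
  have rc': "r \<le> d x y" using rc e0 by (meson add_increasing2 le_add_same_cancel1 less_imp_le order_trans)
  have m: "\<chi> r \<in> X" and m': "\<chi> (r + e) \<in> X"
    using geodesic_in[OF \<chi>(1)] r0 re0 rc rc' by auto
  have py: "d p y = d p x + d x y - (r + r) - e" by (simp add: e_def l_def)
  \<comment> \<open>The alternative towards \<open>y\<close> would give a value smaller by
    \<open>e\<close>, violating the triangle inequality. For \<open>dm'\<close> the alternative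
    towards \<open>x\<close> fails in the same way.\<close>
  have dm: "d p (\<chi> r) = d p x - r"
  proof -
    have "d p x \<le> d p (\<chi> r) + r"
      using triangle[OF X(1) m X(2)] sym[OF m X(2)] geodesic_from[OF \<chi>(1) r0 rc'] \<chi>(2) by simp
    moreover have "d p x = d p (\<chi> r) + r \<or> d p y = d p (\<chi> r) + (d x y - r)"
      using through_point_to_one_end[OF ax1 ax2 \<chi>(1) r0 rc' X(1)] \<chi> by simp
    ultimately show ?thesis using e0 unfolding py
      by (auto simp: algebra_simps)
  qed
  have dm': "d p (\<chi> (r + e)) = d p x - r"
  proof -
    have "d p y \<le> d p (\<chi> (r + e)) + (d x y - (r + e))"
      using triangle[OF X(1) m' X(3)] geodesic_dist[OF \<chi>(1) re0 rc] \<chi>(3) by simp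
    moreover have "d p x = d p (\<chi> (r + e)) + (r + e) \<or>
        d p y = d p (\<chi> (r + e)) + (d x y - (r + e))"
      using through_point_to_one_end[OF ax1 ax2 \<chi>(1) re0 rc X(1)] \<chi> by simp
    ultimately show ?thesis using e0 unfolding py
      by (auto simp: algebra_simps)
  qed
  obtain \<gamma> where \<gamma>: "geodesic X d (d (\<chi> r) p) \<gamma>" "\<gamma> 0 = \<chi> r" "\<gamma> (d (\<chi> r) p) = p"
    using geodesic_between[OF ax1 m X(1)] .
  have fwd: "geodesic X d e (\<lambda>t. \<chi> (r + t))"
    using r0 rc e0 by (intro geodesic_forward[OF \<chi>(1)]) auto
  \<comment> \<open>Both ends of \<open>fwd\<close> are equally far from \<open>p\<close>, so the
    distance from \<open>p\<close> to its far end is not the sum of the lengths. The meeting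
    parameter is positive and at most \<open>e\<close>, hence equal to \<open>e\<close>.\<close>
  obtain t where t: "0 < t" "t \<le> d (\<chi> r) p" "t \<le> e" "\<gamma> t = \<chi> (r + t)"
    using geodesics_meet[OF ax2 \<gamma>(1) fwd] \<gamma> dm dm' e0 sym[OF m X(1)] by auto
  then have "\<gamma> e = \<chi> (r + e)" "e \<le> d (\<chi> r) p" using e_le[of t] by auto
  then have "d p (\<chi> (r + e)) = d (\<chi> r) p - e"
    using geodesic_dist[OF \<gamma>(1), of e "d (\<chi> r) p"] e0 \<gamma>(3) sym[OF m' X(1)] by auto
  then show False using dm dm' sym[OF m X(1)] e0 by simp
qed

text \<open>The triangle inequality bounds \<open>k + k\<close> by 0 and \<open>c + c\<close>. For
  this \<open>k\<close>, half of a doubled Gromov product, both alternatives of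
  \<open>through_point_to_one_end\<close> give the same distance.\<close>

lemma dist_to_center:
  assumes ax1: "axiom1 X d" and ax2: "axiom2 X d" and p: "p \<in> X"
    and \<chi>: "geodesic X d c \<chi>" and k: "k + k = d p (\<chi> 0) + c - d p (\<chi> c)"
  shows "0 \<le> k \<and> k \<le> c \<and> d p (\<chi> k) = d p (\<chi> 0) - k"
proof -
  have c0: "0 \<le> c" using \<chi> by (rule geodesic_nonneg)
  have ends: "\<chi> 0 \<in> X" "\<chi> c \<in> X" using geodesic_in[OF \<chi>] c0 by auto
  have c: "d (\<chi> 0) (\<chi> c) = c" using geodesic_from[OF \<chi> c0] by simp
  have "0 + 0 \<le> k + k"
    using triangle[OF p ends] c unfolding k by simp
  then have k0: "0 \<le> k" unfolding double_le_iff .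
  have "k + k \<le> c + c"
    using triangle[OF p ends(2,1)] c sym[OF ends] unfolding k by (simp add: algebra_simps)
  then have kc: "k \<le> c" unfolding double_le_iff .
  have b: "d p (\<chi> c) = d p (\<chi> 0) + c - (k + k)" unfolding k by simp
  show ?thesis
    using through_point_to_one_end[OF ax1 ax2 \<chi> k0 kc p] k0 kc unfolding b
    by (auto simp: algebra_simps)
qed

text \<open>This is uniqueness of geodesics: a point between the ends in terms of distances already
  determines its place on any geodesic joining them.\<close>

lemma on_every_geodesic:
  assumes half: "halves_have_maximum TYPE('l)"
    and ax1: "axiom1 X d" and ax2: "axiom2 X d"
    and \<phi>: "geodesic X d a \<phi>" and m: "m \<in> X" and a: "d (\<phi> 0) m + d m (\<phi> a) = a"
  shows "\<phi> (d (\<phi> 0) m) = m"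
proof -
  define t where "t = d (\<phi> 0) m"
  have a0: "0 \<le> a" using \<phi> by (rule geodesic_nonneg)
  have ends: "\<phi> 0 \<in> X" "\<phi> a \<in> X" using geodesic_in[OF \<phi>] a0 by auto
  have t: "0 \<le> t" "t \<le> a" using nonneg[OF ends(1) m] nonneg[OF m ends(2)] a
    unfolding t_def by (auto intro: le_add_same_cancel1[THEN iffD2, THEN ord_le_eq_trans])
  then have m': "\<phi> t \<in> X" by (rule geodesic_in[OF \<phi>])
  obtain \<chi> where \<chi>: "geodesic X d (d m (\<phi> t)) \<chi>" "\<chi> 0 = m" "\<chi> (d m (\<phi> t)) = \<phi> t"
    using geodesic_between[OF ax1 m m'] .
  have eq: "d (\<phi> 0) m = t" "d (\<phi> 0) (\<phi> t) = t" "d (\<phi> a) m = a - t" "d (\<phi> a) (\<phi> t) = a - t"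
  proof -
    show "d (\<phi> 0) m = t" by (simp add: t_def)
    show "d (\<phi> 0) (\<phi> t) = t" by (rule geodesic_from[OF \<phi> t])
    have "d m (\<phi> a) = a - t" using a by (simp add: t_def eq_diff_eq add.commute)
    then show "d (\<phi> a) m = a - t" using sym[OF ends(2) m] by simp
    show "d (\<phi> a) (\<phi> t) = a - t"
      using geodesic_dist[OF \<phi> t] sym[OF ends(2) m'] by simp
  qed
  \<comment> \<open>\<open>m\<close> and \<open>\<phi> t\<close> are equidistant from
    \<open>\<phi> 0\<close>, so the doubled Gromov product reduces to their own distance.\<close>
  obtain k where k: "k + k = d m (\<phi> t)"
    using even_gromov_product[OF half ax1 ax2 ends(1) m m'] eq by auto
  \<comment> \<open>The midpoint of a geodesic from m to \<open>\<phi> t\<close> is closer than both to \<open>\<phi> 0\<close> and to \<open>\<phi> a\<close>.\<close>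
  have c: "0 \<le> k" "k \<le> d m (\<phi> t)" "d (\<phi> 0) (\<chi> k) = t - k" "d (\<phi> a) (\<chi> k) = a - t - k"
    using dist_to_center[OF ax1 ax2 ends(1) \<chi>(1), of k]
      dist_to_center[OF ax1 ax2 ends(2) \<chi>(1), of k] \<chi> eq k by auto
  have "\<chi> k \<in> X" using c geodesic_in[OF \<chi>(1)] by auto
  then have "a \<le> (t - k) + (a - t - k)"
    using triangle[OF ends(1) _ ends(2)] c sym ends geodesic_from[OF \<phi> a0] by (metis order_refl)
  then have "k + k \<le> 0 + 0" by (simp add: algebra_simps)
  then have "d m (\<phi> t) = 0" using c k unfolding double_le_iff by auto
  then show ?thesis using zero_iff m m' unfolding t_def by auto
qed

text \<open>The geodesics from \<open>p\<close> separate exactly at \<open>k\<close>, the Gromov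
  product of their far ends based at \<open>p\<close>.\<close>

lemma axiom3_of_halves:
  assumes half: "halves_have_maximum TYPE('l)"
    and ax1: "axiom1 X d" and ax2: "axiom2 X d"
  shows "axiom3 X d"
  unfolding axiom3_def
proof (intro allI impI, elim conjE exE)
  fix s s' p
  assume "endpoint X d s p" "endpoint X d s' p"
  then obtain a \<phi> b \<psi> where \<phi>: "geodesic X d a \<phi>" "\<phi> 0 = p" and s: "s = \<phi> ` {0..a}"
    and \<psi>: "geodesic X d b \<psi>" "\<psi> 0 = p" and s': "s' = \<psi> ` {0..b}"
    by (meson endpoint_geodesic)
  have a0: "0 \<le> a" and b0: "0 \<le> b" using \<phi> \<psi> by (auto dest: geodesic_nonneg)
  have X: "p \<in> X" "\<phi> a \<in> X" "\<psi> b \<in> X"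
    using \<phi> \<psi> a0 b0 by (auto intro: geodesic_in)
  have pa: "d (\<phi> a) p = a" and pb: "d p (\<psi> b) = b"
    using geodesic_from[OF \<phi>(1) a0] geodesic_from[OF \<psi>(1) b0] \<phi> \<psi> sym[OF X(1,2)] by auto
  obtain k where k: "k + k = a + b - d (\<phi> a) (\<psi> b)"
    using even_gromov_product[OF half ax1 ax2 X(2,1,3)] pa pb by auto
  then have kb: "0 \<le> k" "k \<le> b" "d (\<phi> a) (\<psi> k) = a - k"
    using dist_to_center[OF ax1 ax2 X(2) \<psi>(1), of k] pa \<psi>(2) by auto
  have \<psi>k: "\<psi> k \<in> X" using geodesic_in[OF \<psi>(1)] kb by auto
  have ka: "k \<le> a" using kb(3) nonneg[OF X(2) \<psi>k] by simp
  \<comment> \<open>Going from \<open>p\<close> to \<open>\<psi> k\<close> and on to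
    \<open>\<phi> a\<close> has total length \<open>a\<close>, so \<open>\<psi> t\<close> is between
    \<open>p\<close> and \<open>\<phi> a\<close> and lies on \<open>\<phi>\<close> too.\<close>
  have below: "\<phi> t = \<psi> t" if t: "0 \<le> t" "t \<le> k" for t
  proof -
    have t': "t \<le> a" "t \<le> b" using t ka kb by auto
    then have \<psi>t: "\<psi> t \<in> X" "\<phi> t \<in> X" using geodesic_in[OF \<psi>(1)] geodesic_in[OF \<phi>(1)] t(1) by blast+
    have pt: "d p (\<psi> t) = t" using geodesic_from[OF \<psi>(1)] t t' \<psi>(2) by auto
    have "d (\<psi> t) (\<phi> a) \<le> d (\<psi> t) (\<psi> k) + d (\<psi> k) (\<phi> a)"
      using triangle \<psi>t \<psi>k X by blast
    also have "\<dots> = a - t"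
      using geodesic_dist[OF \<psi>(1) t kb(2)] kb(3) sym[OF X(2) \<psi>k] by simp
    finally have "d (\<psi> t) (\<phi> a) = a - t"
      using triangle[OF X(1) \<psi>t(1) X(2)] pt pa sym[OF X(1,2)] by (simp add: algebra_simps)
    then show ?thesis
      using on_every_geodesic[OF half ax1 ax2 \<phi>(1) \<psi>t(1)] pt \<phi>(2) by simp
  qed
  \<comment> \<open>A common point at \<open>t\<close> allows a path of length
    \<open>(a - t) + (b - t)\<close> between the far ends.\<close>
  have above: "t \<le> k" if t: "0 \<le> t" "t \<le> a" "t \<le> b" "\<phi> t = \<psi> t" for t
  proof -
    have "\<phi> t \<in> X" using geodesic_in[OF \<phi>(1) t(1,2)] .
    then have "d (\<phi> a) (\<psi> b) \<le> (a - t) + (b - t)"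
      using triangle[OF X(2) _ X(3)] sym[OF X(2)] geodesic_dist[OF \<phi>(1) t(1,2)]
        geodesic_dist[OF \<psi>(1) t(1,3)] t(4) a0 b0 by (metis order_refl)
    then have "t + t \<le> k + k" unfolding k by (simp add: algebra_simps)
    then show ?thesis unfolding double_le_iff .
  qed
  have "s \<inter> s' = \<phi> ` {0..k}"
  proof (intro equalityI subsetI)
    fix z assume "z \<in> s \<inter> s'"
    then obtain t t' where t: "0 \<le> t" "t \<le> a" "0 \<le> t'" "t' \<le> b" "z = \<phi> t" "z = \<psi> t'"
      using s s' by auto
    then have "t = t'"
      using geodesics_meet_same_parameter[OF \<phi>(1) \<psi>(1)] \<phi>(2) \<psi>(2) by metis
    then show "z \<in> \<phi> ` {0..k}" using above t by auto
  next
    fix z assume "z \<in> \<phi> ` {0..k}"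
    then obtain t where "0 \<le> t" "t \<le> k" "z = \<phi> t" by auto
    then show "z \<in> s \<inter> s'" using below ka kb s s' by (auto intro!: image_eqI[of _ _ t])
  qed
  moreover have "geodesic X d k \<phi>" using geodesic_forward[OF \<phi>(1), of 0 k] kb ka by simp
  ultimately show "segment X d (s \<inter> s')" using segment_of_geodesic by metis
qed

end

section \<open>A triangle of rays\<close>

text \<open>
  The points \<open>pt i t\<close> with fixed \<open>i\<close> form a ray starting at a vertex of a triangle with sides
  of length \<open>l0\<close>.  A side consists of two full rays that meet nowhere, as \<open>H\<close> has no maximum.
\<close>

locale three_rays =
  fixes l0 :: "'l::linordered_ab_group_add"
    and pt :: "nat \<Rightarrow> 'l \<Rightarrow> 'x" and ix :: "'x \<Rightarrow> nat" and ht :: "'x \<Rightarrow> 'l"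
    and H :: "'l set"
  assumes pos: "0 < l0"
    and H_iff: "t \<in> H \<longleftrightarrow> 0 \<le> t \<and> t + t \<le> l0"
    and no_max: "\<not> is_maximum r H"
    and ix_pt: "i < 3 \<Longrightarrow> t \<in> H \<Longrightarrow> ix (pt i t) = i"
    and ht_pt: "i < 3 \<Longrightarrow> t \<in> H \<Longrightarrow> ht (pt i t) = t"
begin

definition X :: "'x set" where
  "X = {pt i t |i t. i < 3 \<and> t \<in> H}"

text \<open>Heights are measured from the vertex of each ray. Two different rays enter a common side
  of length \<open>l0\<close> from opposite ends, which leaves the stated difference.\<close>

definition D :: "'x \<Rightarrow> 'x \<Rightarrow> 'l" where
  "D x y = (if ix x = ix y then dist_Lambda (ht x) (ht y) else l0 - ht x - ht y)"

lemma X_D: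
  assumes "x \<in> X" shows "ix x < 3" "ht x \<in> H" "pt (ix x) (ht x) = x"
  using assms by (auto simp: X_def ix_pt ht_pt)

lemma X_eqI: "x \<in> X \<Longrightarrow> y \<in> X \<Longrightarrow> ix x = ix y \<Longrightarrow> ht x = ht y \<Longrightarrow> x = y"
  by (metis X_D(3))

lemma pt_in_X: "i < 3 \<Longrightarrow> t \<in> H \<Longrightarrow> pt i t \<in> X"
  by (auto simp: X_def)

lemma H_above: "t \<in> H \<Longrightarrow> \<exists>t'\<in>H. t < t'"
  using no_max[of t] unfolding is_maximum_def by (auto simp: not_le)

text \<open>Strictness comes from the missing maximum; it keeps different rays at positive
  distance.\<close>

lemma H_less: "t \<in> H \<Longrightarrow> t + t < l0"
  using H_above H_iff double_less_iff by (metis less_le_trans)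

lemma H_add_less:
  assumes "s \<in> H" "t \<in> H" shows "s + t < l0"
proof -
  have "(s + t) + (s + t) < l0 + l0"
    using add_strict_mono[OF H_less[OF assms(1)] H_less[OF assms(2)]] by (simp add: algebra_simps)
  then show ?thesis unfolding double_less_iff .
qed

lemma H_mono: "t \<in> H \<Longrightarrow> 0 \<le> s \<Longrightarrow> s \<le> t \<Longrightarrow> s \<in> H"
  unfolding H_iff using add_mono[of s t s t] by auto

lemma zero_in_H: "0 \<in> H"
  using pos by (simp add: H_iff)

lemma metric: "lambda_metric_space X D"
proof
  fix x y z assume x: "x \<in> X" and y: "y \<in> X"
  have xy: "ht x + ht y < l0" by (rule H_add_less[OF X_D(2) X_D(2)]) fact+
  show "0 \<le> D x y"
    using xy by (simp add: D_def dist_Lambda_nonneg algebra_simps less_imp_le)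
  show "D x y = 0 \<longleftrightarrow> x = y"
    using xy X_eqI[OF x y] by (auto simp: D_def dist_Lambda_zero_iff algebra_simps)
  show "D x y = D y x"
    by (simp add: D_def dist_Lambda_commute algebra_simps)
  assume z: "z \<in> X"
  have yz: "ht y + ht z < l0" by (rule H_add_less[OF X_D(2) X_D(2)]) fact+
  have yy: "ht y + ht y < l0" by (rule H_less[OF X_D(2)]) fact+
  consider "ix x = ix y" "ix y = ix z" | "ix x = ix y" "ix y \<noteq> ix z"
    | "ix x \<noteq> ix y" "ix y = ix z" | "ix x = ix z" "ix y \<noteq> ix z"
    | "ix x \<noteq> ix y" "ix y \<noteq> ix z" "ix x \<noteq> ix z" by blast
  then show "D x z \<le> D x y + D y z"
  proof cases
    case 1
    then show ?thesis by (simp add: D_def dist_Lambda_triangle)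
  next
    case 2
    then show ?thesis using dist_Lambda_ge(1)[of "ht y" "ht x"] by (simp add: D_def algebra_simps)
  next
    case 3
    then show ?thesis using dist_Lambda_ge(2)[of "ht y" "ht z"] by (simp add: D_def algebra_simps)
  next
    case 4
    have "(ht x + ht y) + (ht y + ht x) \<le> l0 + l0" "(ht y + ht z) + (ht y + ht z) \<le> l0 + l0"
      using add_mono[of "ht x + ht y" l0 "ht x + ht y" l0] add_mono[of "ht y + ht z" l0 "ht y + ht z" l0] xy yz
      by (auto simp: add.commute)
    then have "dist_Lambda (ht x) (ht z) \<le> (l0 - ht x - ht y) + (l0 - ht y - ht z)"
      unfolding dist_Lambda_le_iff by (simp add: algebra_simps)
    then show ?thesis using 4 by (simp add: D_def)
  next
    \<comment> \<open>For three different rays the inequality amounts to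
      \<open>ht y + ht y \<le> l0\<close>: this is why the sides are glued no further than half
      their length.\<close>
    case 5
    then show ?thesis using yy by (simp add: D_def algebra_simps less_imp_le)
  qed
qed

lemma ray_segment:
  assumes i: "i < 3" and H: "s \<in> H" "t \<in> H" and st: "s \<le> t"
  shows "segment_ends X D (pt i ` {s..t}) {pt i s, pt i t}"
proof -
  have "u \<in> H" if "u \<in> {s..t}" for u
    using that H_mono[OF H(2), of u] H(1)[unfolded H_iff] by auto
  then have "isometric_embedding X D s t (pt i)"
    using i unfolding isometric_embedding_def by (auto simp: D_def ix_pt ht_pt pt_in_X)
  then show ?thesis unfolding segment_ends_def using st by blast
qed

text \<open>\<open>u\<close> is the distance from vertex \<open>i\<close>. Past the half, ray
  \<open>j\<close> takes over, with height measured from its own vertex.\<close>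

definition side :: "nat \<Rightarrow> nat \<Rightarrow> 'l \<Rightarrow> 'x" where
  "side i j u = (if u + u \<le> l0 then pt i u else pt j (l0 - u))"

lemma side_segment:
  assumes i: "i < 3" and j: "j < 3" and ij: "i \<noteq> j" and H: "s \<in> H" "t \<in> H"
  shows "segment_ends X D (side i j ` {s..l0 - t}) {pt i s, pt j t}"
proof -
  have low: "u \<in> H" if "s \<le> u" "u + u \<le> l0" for u
    using that H by (auto simp: H_iff)
  have high: "l0 - u \<in> H" if "u \<le> l0 - t" "\<not> u + u \<le> l0" for u
  proof -
    have "t \<le> l0 - u" using that by (simp add: algebra_simps)
    then have "0 \<le> l0 - u" using H order_trans unfolding H_iff by blast
    then show ?thesis using that unfolding H_iff by (simp add: algebra_simps)
  qed
  have mixed: "D (pt i u) (pt j (l0 - v)) = dist_Lambda u v"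
    if "s \<le> u" "u + u \<le> l0" "v \<le> l0 - t" "\<not> v + v \<le> l0" for u v
  proof -
    have "u + u < v + v" using that by auto
    then have "u \<le> v" unfolding double_less_iff by simp
    then show ?thesis using that ij i j low[of u] high[of v]
      by (simp add: D_def ix_pt ht_pt dist_Lambda_le)
  qed
  have "side i j u \<in> X" if "u \<in> {s..l0 - t}" for u
    using that i j low high by (auto simp: side_def pt_in_X)
  moreover have "D (side i j u) (side i j v) = dist_Lambda u v"
    if "u \<in> {s..l0 - t}" "v \<in> {s..l0 - t}" for u v
  proof -
    have "D (pt j (l0 - v)) (pt i u) = D (pt i u) (pt j (l0 - v))" for u v
      by (simp add: D_def dist_Lambda_commute algebra_simps)
    moreover have "D (pt i u) (pt i v) = dist_Lambda u v" if "u + u \<le> l0" "v + v \<le> l0"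
      using that low[of u] low[of v] \<open>u \<in> _\<close> \<open>v \<in> _\<close> i by (simp add: D_def ix_pt ht_pt)
    moreover have "D (pt j (l0 - u)) (pt j (l0 - v)) = dist_Lambda u v"
      if "\<not> u + u \<le> l0" "\<not> v + v \<le> l0"
      using that high[of u] high[of v] \<open>u \<in> _\<close> \<open>v \<in> _\<close> j
      by (simp add: D_def ix_pt ht_pt dist_Lambda_def max.commute)
    ultimately show ?thesis
      using that mixed[of u v] mixed[of v u] by (simp add: side_def dist_Lambda_commute)
  qed
  ultimately have "isometric_embedding X D s (l0 - t) (side i j)"
    unfolding isometric_embedding_def by auto
  moreover have "side i j s = pt i s" using H by (simp add: side_def H_iff)
  moreover have "side i j (l0 - t) = pt j t" using H_less[OF H(2)] by (auto simp: side_def algebra_simps)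
  moreover have "s \<le> l0 - t" using H_add_less[OF H] by (simp add: algebra_simps less_imp_le)
  ultimately show ?thesis unfolding segment_ends_def by metis
qed

lemma axiom1_holds: "axiom1 X D"
  unfolding axiom1_def
proof (intro ballI)
  fix p q assume "p \<in> X" "q \<in> X"
  then obtain i s j t where p: "p = pt i s" "i < 3" "s \<in> H" and q: "q = pt j t" "j < 3" "t \<in> H"
    by (auto simp: X_def)
  show "\<exists>s. segment_ends X D s {p, q}"
  proof (cases "i = j")
    case True
    then show ?thesis using ray_segment[of i s t] ray_segment[of i t s] p q
      by (metis insert_commute linear)
  next
    case False
    then show ?thesis using side_segment p q by metis
  qed
qed

section \<open>Directions at a point, and axiom 2 for the triangle\<close>

text \<open>These points lie in the direction of the vertex of the ray of \<open>p\<close>. All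
  points other than these and \<open>p\<close> are reached from \<open>p\<close> by first moving up
  that ray.\<close>

definition below :: "'x \<Rightarrow> 'x \<Rightarrow> bool" where
  "below p x \<longleftrightarrow> ix x = ix p \<and> ht x < ht p"

lemma opposite_sides:
  assumes "below p x" "\<not> below p y"
  shows "D x y = D p x + D p y"
  using assms
  by (auto simp: D_def below_def dist_Lambda_le dist_Lambda_commute[of "ht p" "ht x"] not_less)

text \<open>A geodesic cannot leave its start in both directions: by \<open>opposite_sides\<close>
  two such points would be \<open>r + r'\<close> apart.\<close>

lemma geodesic_below:
  assumes \<phi>: "geodesic X D a \<phi>" and r: "0 < r" "r \<le> a" "below (\<phi> 0) (\<phi> r)"
    and r': "0 < r'" "r' \<le> a"
  shows "below (\<phi> 0) (\<phi> r')"
proof (rule ccontr)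
  assume "\<not> ?thesis"
  then have "D (\<phi> r) (\<phi> r') = r + r'"
    using opposite_sides r r' geodesic_from[OF \<phi>] by (metis less_imp_le)
  moreover have "D (\<phi> r) (\<phi> r') = dist_Lambda r r'"
    using \<phi> r r' unfolding geodesic_def isometric_embedding_def by auto
  ultimately show False
    using dist_Lambda_cases[of r r' "r + r'"] r r' double_eq_iff[of r 0] double_eq_iff[of r' 0]
    by (auto simp: algebra_simps)
qed

lemma below_unique:
  assumes "x \<in> X" "y \<in> X" "below p x" "below p y" "D p x = D p y"
  shows "x = y"
  using assms
  by (auto intro!: X_eqI simp: below_def D_def dist_Lambda_le dist_Lambda_commute[of "ht p"])

text \<open>Upwards, a distance determines the point as long as it does not lead out of the ray of
  \<open>p\<close>. Reaching another ray takes the height \<open>l0 - ht x\<close>, which lies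
  outside \<open>H\<close>.\<close>

lemma not_below_unique:
  assumes "x \<in> X" and nb: "\<not> below p x" and H: "ht p + D p x \<in> H" and p: "p \<in> X"
  shows "x = pt (ix p) (ht p + D p x)"
proof -
  have "ix x = ix p"
  proof (rule ccontr)
    assume "ix x \<noteq> ix p"
    then have "ht p + D p x = l0 - ht x" by (simp add: D_def)
    then show False
      using H_add_less[OF H X_D(2)[OF \<open>x \<in> X\<close>]] by simp
  qed
  then show ?thesis
    using nb X_D[OF \<open>x \<in> X\<close>] by (auto simp: below_def D_def dist_Lambda_le not_less)
qed

text \<open>Two geodesics leaving \<open>p\<close> in the same direction share a second point, so
  those meeting only at \<open>p\<close> leave in opposite directions and concatenate.\<close>

lemma axiom2_holds: "axiom2 X D"
  unfolding axiom2_def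
proof (intro allI impI, elim conjE)
  fix s s' p
  assume seg: "segment X D s" "segment X D s'" and int: "s \<inter> s' = {p}"
    and "endpoint X D s p" "endpoint X D s' p"
  then obtain a \<phi> b \<psi> where \<phi>: "geodesic X D a \<phi>" "\<phi> 0 = p" and s: "s = \<phi> ` {0..a}"
    and \<psi>: "geodesic X D b \<psi>" "\<psi> 0 = p" and s': "s' = \<psi> ` {0..b}"
    by (meson endpoint_geodesic)
  interpret lambda_metric_space X D by (rule metric)
  have a0: "0 \<le> a" and b0: "0 \<le> b" using \<phi> \<psi> by (auto dest: geodesic_nonneg)
  have p: "p \<in> X" using \<phi> a0 by (metis geodesic_in order_refl)
  show "segment X D (s \<union> s')"
  proof (cases "a = 0 \<or> b = 0")
    case True
    then have "s \<union> s' = s \<or> s \<union> s' = s'" using \<phi>(2) \<psi>(2) s s' int by auto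
    then show ?thesis using seg by metis
  next
    case False
    then have ab: "0 < a" "0 < b" using a0 b0 by auto
    have distinct: "\<phi> r \<noteq> \<psi> r" if r: "0 < r" "r \<le> a" "r \<le> b" for r
    proof
      assume "\<phi> r = \<psi> r"
      then have "\<phi> r \<in> s \<inter> s'" using r s s' by (auto intro!: image_eqI[of _ _ r])
      then have "\<phi> r = p" using int by auto
      then show False using geodesic_from[OF \<phi>(1), of r] geodesic_from[OF \<phi>(1), of 0] \<phi>(2) r a0 by auto
    qed
    have from_p: "D p (\<phi> r) = r" "\<phi> r \<in> X" if "0 < r" "r \<le> a" for r
      using geodesic_from[OF \<phi>(1), of r] geodesic_in[OF \<phi>(1), of r] \<phi>(2) that by auto
    have from_p': "D p (\<psi> r) = r" "\<psi> r \<in> X" if "0 < r" "r \<le> b" for r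
      using geodesic_from[OF \<psi>(1), of r] geodesic_in[OF \<psi>(1), of r] \<psi>(2) that by auto
    define c where "c = min a b"
    have c: "0 < c" "c \<le> a" "c \<le> b" using ab by (auto simp: c_def)
    have "\<not> (below p (\<phi> c) \<and> below p (\<psi> c))"
      using below_unique distinct c from_p from_p' by metis
    moreover have "below p (\<phi> c) \<or> below p (\<psi> c)"
    proof (rule ccontr)
      assume nb: "\<not> ?thesis"
      \<comment> \<open>As \<open>H\<close> has no maximum, there is room above \<open>p\<close> on
        its own ray. Within this room two upward geodesics coincide.\<close>
      obtain t where t: "t \<in> H" "ht p < t" using H_above X_D(2)[OF p] by blast
      define r where "r = min c (t - ht p)"
      have r: "0 < r" "r \<le> a" "r \<le> b" using c t by (auto simp: r_def min_le_iff_disj)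
      have "r \<le> t - ht p" by (simp add: r_def)
      then have "ht p + r \<in> H"
        using r X_D(2)[OF p] by (intro H_mono[OF t(1)]) (auto simp: H_iff algebra_simps)
      moreover have "\<not> below p (\<phi> r)" "\<not> below p (\<psi> r)"
        using geodesic_below[OF \<phi>(1), of r c] geodesic_below[OF \<psi>(1), of r c] \<phi>(2) \<psi>(2) r c nb by auto
      ultimately have "\<phi> r = \<psi> r"
        using not_below_unique p from_p from_p' r by metis
      then show False using distinct r by blast
    qed
    moreover have "segment X D (s \<union> s')" if "below p (\<phi> c)" "\<not> below p (\<psi> c)"
      unfolding s s'
    proof (rule geodesics_concat[OF \<phi>(1) \<psi>(1)])
      fix r r' assume r: "0 < r" "r \<le> a" "0 < r'" "r' \<le> b"
      have "below p (\<phi> r)" "\<not> below p (\<psi> r')"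
        using geodesic_below[OF \<phi>(1), of c r] geodesic_below[OF \<psi>(1), of r' c] that \<phi>(2) \<psi>(2) r c by auto
      then show "D (\<phi> r) (\<psi> r') = r + r'"
        using opposite_sides from_p from_p' r by metis
    qed (use \<phi> \<psi> in simp)
    moreover have "segment X D (s' \<union> s)" if "below p (\<psi> c)" "\<not> below p (\<phi> c)"
      unfolding s s'
    proof (rule geodesics_concat[OF \<psi>(1) \<phi>(1)])
      fix r' r assume r: "0 < r'" "r' \<le> b" "0 < r" "r \<le> a"
      have "below p (\<psi> r')" "\<not> below p (\<phi> r)"
        using geodesic_below[OF \<psi>(1), of c r'] geodesic_below[OF \<phi>(1), of r c] that \<phi>(2) \<psi>(2) r c by auto
      then show "D (\<psi> r') (\<phi> r) = r' + r"
        using opposite_sides from_p from_p' r by metis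
    qed (use \<phi> \<psi> in simp)
    ultimately show ?thesis by (metis Un_commute)
  qed
qed

section \<open>Failure of axiom 3 for the triangle\<close>

text \<open>The bound has the form \<open>l0 - 0\<close> to match \<open>side_segment\<close> with
  both heights 0.\<close>

lemma side_image:
  assumes "i < 3" "j < 3"
  shows "side i j ` {0..l0 - 0} = pt i ` H \<union> pt j ` H"
proof (intro equalityI subsetI)
  fix z assume "z \<in> side i j ` {0..l0 - 0}"
  then obtain u where u: "0 \<le> u" "u \<le> l0" "z = side i j u" by auto
  show "z \<in> pt i ` H \<union> pt j ` H"
    using u by (cases "u + u \<le> l0") (auto simp: side_def H_iff algebra_simps)
next
  fix z assume "z \<in> pt i ` H \<union> pt j ` H"
  then consider t where "t \<in> H" "z = pt i t" | t where "t \<in> H" "z = pt j t" by auto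
  then show "z \<in> side i j ` {0..l0 - 0}"
  proof cases
    case 1
    then show ?thesis using H_add_less[OF zero_in_H, of t]
      by (intro image_eqI[of _ _ t]) (auto simp: side_def H_iff)
  next
    case 2
    then show ?thesis using H_add_less[OF zero_in_H, of t] H_less[of t]
      by (intro image_eqI[of _ _ "l0 - t"]) (auto simp: side_def H_iff algebra_simps)
  qed
qed

text \<open>Above the heights \<open>u\<close>, \<open>v\<close> of the ends there is a further
  point of the ray, at height \<open>w\<close>. It would have to lie between the ends, but its
  distances to them add up to more than their distance.\<close>

lemma ray_not_segment: "\<not> segment X D (pt 0 ` H)"
proof
  assume "segment X D (pt 0 ` H)"
  then obtain a b \<theta> where ab: "a \<le> b" and iso: "isometric_embedding X D a b \<theta>"
    and ray: "pt 0 ` H = \<theta> ` {a..b}"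
    unfolding segment_def segment_ends_def by blast
  have "\<theta> a \<in> pt 0 ` H" "\<theta> b \<in> pt 0 ` H" using ab by (auto simp: ray)
  then obtain u v where uv: "u \<in> H" "v \<in> H" "\<theta> a = pt 0 u" "\<theta> b = pt 0 v" by blast
  have "max u v \<in> H" using uv by (simp add: max_def)
  then obtain w where w: "w \<in> H" "u < w" "v < w" using H_above by (metis max_less_iff_conj)
  then have "pt 0 w \<in> \<theta> ` {a..b}" by (simp flip: ray)
  then obtain e where e: "a \<le> e" "e \<le> b" "\<theta> e = pt 0 w" by auto
  have dist: "D (\<theta> x) (\<theta> y) = y - x" if "a \<le> x" "x \<le> y" "y \<le> b" for x y
    using iso that unfolding isometric_embedding_def by (auto simp: dist_Lambda_le)
  have "w - u = e - a" "w - v = b - e" "dist_Lambda u v = b - a"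
    using dist[of a e] dist[of e b] dist[of a b] e ab uv w
    by (auto simp: D_def ix_pt ht_pt dist_Lambda_le dist_Lambda_commute[of w])
  then have "dist_Lambda u v = (w - u) + (w - v)" by simp
  moreover have "dist_Lambda u v < (w - u) + (w - v)"
    using w add_strict_mono[OF w(2,2)] add_strict_mono[OF w(3,3)]
    unfolding dist_Lambda_def max_less_iff_conj by (simp add: algebra_simps)
  ultimately show False by simp
qed

lemma axiom3_fails: "\<not> axiom3 X D"
proof
  assume ax3: "axiom3 X D"
  have s: "segment_ends X D (pt 0 ` H \<union> pt j ` H) {pt 0 0, pt j 0}" if "j < 3" "0 < j" for j
    using side_segment[of 0 j 0 0] side_image[of 0 j] that zero_in_H by simp
  have seg: "segment X D (pt 0 ` H \<union> pt j ` H)" "endpoint X D (pt 0 ` H \<union> pt j ` H) (pt 0 0)"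
    if "j < 3" "0 < j" for j
    using s[OF that] unfolding segment_def endpoint_def by (metis, metis insertI1)
  have "segment X D ((pt 0 ` H \<union> pt 1 ` H) \<inter> (pt 0 ` H \<union> pt 2 ` H))"
    using ax3 seg[of 1] seg[of 2] unfolding axiom3_def by fastforce
  moreover have "(pt 0 ` H \<union> pt 1 ` H) \<inter> (pt 0 ` H \<union> pt 2 ` H) = pt 0 ` H"
  proof -
    have "pt 1 t \<noteq> pt 0 t'" "pt 1 t \<noteq> pt 2 t'" if "t \<in> H" "t' \<in> H" for t t'
      using that ix_pt[of 0 t'] ix_pt[of 1 t] ix_pt[of 2 t'] by auto
    then show ?thesis by auto
  qed
  ultimately show False using ray_not_segment by simp
qed

end

section \<open>Realization inside the group, and the equivalence\<close>

lemma axiom3_failure_without_maximum: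
  fixes l0 :: "'l::linordered_ab_group_add"
  assumes pos: "0 < l0" and no_max: "\<And>r. \<not> is_maximum r {t. 0 \<le> t + t \<and> t + t \<le> l0}"
  shows "\<exists>(X :: 'l set) (d :: 'l \<Rightarrow> 'l \<Rightarrow> 'l).
    lambda_metric_space X d \<and> axiom1 X d \<and> axiom2 X d \<and> \<not> axiom3 X d"
proof -
  \<comment> \<open>The three copies of \<open>H\<close>, which lies below \<open>l0\<close>, are made disjoint by translation.\<close>
  define off where "off i = (if i = 0 then 0 else if i = 1 then l0 else l0 + l0)" for i :: nat
  \<comment> \<open>The copies start at 0, \<open>l0\<close> and \<open>l0 + l0\<close>, so
    comparing with the last two recovers the ray.\<close>
  define ix :: "'l \<Rightarrow> nat" where "ix x = (if x < l0 then 0 else if x < l0 + l0 then 1 else 2)" for x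
  interpret three_rays l0 "\<lambda>i t. off i + t" ix "\<lambda>x. x - off (ix x)" "{t. 0 \<le> t + t \<and> t + t \<le> l0}"
  proof
    fix i :: nat and t :: 'l
    assume i: "i < 3" and t: "t \<in> {t. 0 \<le> t + t \<and> t + t \<le> l0}"
    then have "0 \<le> t" by simp
    moreover have "t < l0"
    proof (rule ccontr)
      assume "\<not> t < l0"
      then have "l0 + l0 \<le> t + t" by (intro add_mono) auto
      also have "\<dots> \<le> l0" using t by simp
      finally show False using pos by simp
    qed
    moreover have "\<not> l0 + t < l0" "\<not> l0 + l0 + t < l0" "\<not> l0 + l0 + t < l0 + l0"
      using pos \<open>0 \<le> t\<close> by (simp_all add: not_less add_increasing2 add.assoc)
    moreover have "i = 0 \<or> i = 1 \<or> i = 2" using i by auto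
    ultimately show "ix (off i + t) = i"
      by (elim disjE) (simp_all add: ix_def off_def)
    then show "off i + t - off (ix (off i + t)) = t" by simp
  qed (use pos no_max in auto)
  show ?thesis using metric axiom1_holds axiom2_holds axiom3_fails by blast
qed

text \<open>The counterexample has its points in \<open>'l\<close>, so this one point type suffices
  for the direction from (b) to (a), while the converse holds for every point type
  \<open>'x\<close>.\<close>

theorem theorem1:
  shows "(halves_have_maximum TYPE('l::linordered_ab_group_add) \<longleftrightarrow>
            axioms12_imply_axiom3 TYPE('l) TYPE('l)) \<and>
         (halves_have_maximum TYPE('l) \<longrightarrow> axioms12_imply_axiom3 TYPE('l) TYPE('x))"
proof (intro conjI impI iffI)
  assume "halves_have_maximum TYPE('l)"
  then show "axioms12_imply_axiom3 TYPE('l) TYPE('l)" "axioms12_imply_axiom3 TYPE('l) TYPE('x)"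
    unfolding axioms12_imply_axiom3_def
    by (auto intro: lambda_metric_space.axiom3_of_halves)
next
  assume "axioms12_imply_axiom3 TYPE('l) TYPE('l)"
  then show "halves_have_maximum TYPE('l)"
    using axiom3_failure_without_maximum
    unfolding axioms12_imply_axiom3_def halves_have_maximum_def by blast
qed

end
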